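(* There exist a set $\mathcal S$ of discrete states with a discrete distance $D_{\mathrm{disc}}$ on $\mathcal S$, a dimension $k\ge 1$, an action set $\mathcal A$, a safety predicate $\operatorname{Safe}:(\mathcal S\times\mathbb R^k)\times\mathcal A\to\{0,1\}$, a point $(s,x)\in\mathcal S\times\mathbb R^k$, an action $a\in\mathcal A$, a discrete neighborhood $\mathcal N_d(s)=\{s'\in\mathcal S: D_{\mathrm{disc}}(s,s')\le d\}$ and a continuous ball $B_\varepsilon(x)=\{x'\in\mathbb R^k:\|x'-x\|_2\le\varepsilon\}$ such that $$\operatorname{Safe}((s,x'),a)=1\ \text{ for all } x'\in B_\varepsilon(x)\quad\text{and}\quad \operatorname{Safe}((s',x),a)=1\ \text{ for all } s'\in\mathcal N_d(s),$$ yet $\operatorname{Safe}((s',x'),a)=0$ for some $s'\in\mathcal N_d(s)$ and some $x'\in B_\varepsilon(x)$.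
   Context: A typed return is a pair $z=(s,x)$ with $s\in\mathcal S$ the discrete (categorical) part and $x\in\mathbb R^k$ the continuous (numerical) part. A safety predicate assigns to each return $z$ and candidate action $a\in\mathcal A$ a value $\operatorname{Safe}(z,a)\in\{0,1\}$ ($1$ = safe). $D_{\mathrm{disc}}(s,s')$ is a distance counting discrete edits (nonnegative integer valued, $D_{\mathrm{disc}}(s,s)=0$), $d$ is a nonnegative integer budget, $\varepsilon>0$ is the continuous budget, and $\|\cdot\|_2$ is the Euclidean norm. *)

theory Defs
  imports "HOL-Analysis.Analysis"
begin

text \<open>
  The dimension \<open>k\<close> has to be quantified inside the statement, so \<open>\<real>\<^sup>k\<close> is the carrier of the
  topology \<open>Euclidean_space k\<close>: the sequences \<open>x :: nat \<Rightarrow> real\<close> with \<open>x i = 0\<close> for all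
  \<open>i \<ge> k\<close>. Its Euclidean norm is \<open>L2_set x {..<k}\<close>.
\<close>

abbreviation Rn :: "nat \<Rightarrow> (nat \<Rightarrow> real) set" where
  "Rn k \<equiv> topspace (Euclidean_space k)"

definition euclid_norm :: "nat \<Rightarrow> (nat \<Rightarrow> real) \<Rightarrow> real" where
  "euclid_norm k x = L2_set x {..<k}"

definition cont_ball :: "nat \<Rightarrow> (nat \<Rightarrow> real) \<Rightarrow> real \<Rightarrow> (nat \<Rightarrow> real) set" where
  "cont_ball k x \<epsilon> = {x' \<in> Rn k. euclid_norm k (\<lambda>i. x' i - x i) \<le> \<epsilon>}"

text \<open>
  A distance that counts edits is read as a metric with values in the natural numbers; in
  particular \<open>D s s = 0\<close>, and \<open>D s s' = 0\<close> only for \<open>s = s'\<close>.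
\<close>

definition discrete_distance :: "'s set \<Rightarrow> ('s \<Rightarrow> 's \<Rightarrow> nat) \<Rightarrow> bool" where
  "discrete_distance S D \<longleftrightarrow> Metric_space S (\<lambda>s s'. real (D s s'))"

definition disc_nbhd :: "'s set \<Rightarrow> ('s \<Rightarrow> 's \<Rightarrow> nat) \<Rightarrow> nat \<Rightarrow> 's \<Rightarrow> 's set" where
  "disc_nbhd S D d s = {s' \<in> S. D s s' \<le> d}"

end

theory Submission
  imports Defs
begin

text \<open>Safety along each axis separately says nothing about joint perturbations: a predicate
  can fail exactly when both parts change at once. Take two discrete states at distance 1 and the
  real line, and call a return unsafe iff both its discrete and its continuous part are nonzero.
  From the origin, changing one part alone keeps the other at zero, hence safe; changing both is
  unsafe.\<close>

lemma discrete_distance_01: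
  "discrete_distance S (\<lambda>s s'. if s = s' then 0 else 1)"
  unfolding discrete_distance_def by unfold_locales auto

theorem theorem1:
  shows "\<exists>(S :: nat set) (D :: nat \<Rightarrow> nat \<Rightarrow> nat) (k :: nat) (A :: nat set)
           (Safe :: (nat \<times> (nat \<Rightarrow> real)) \<times> nat \<Rightarrow> nat)
           (s :: nat) (x :: nat \<Rightarrow> real) (a :: nat) (d :: nat) (\<epsilon> :: real).
           discrete_distance S D \<and> k \<ge> 1 \<and>
           Safe \<in> (S \<times> Rn k) \<times> A \<rightarrow> {0, 1} \<and>
           (s, x) \<in> S \<times> Rn k \<and> a \<in> A \<and> \<epsilon> > 0 \<and>
           (\<forall>x' \<in> cont_ball k x \<epsilon>. Safe ((s, x'), a) = 1) \<and>
           (\<forall>s' \<in> disc_nbhd S D d s. Safe ((s', x), a) = 1) \<and>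
           (\<exists>s' \<in> disc_nbhd S D d s. \<exists>x' \<in> cont_ball k x \<epsilon>. Safe ((s', x'), a) = 0)"
proof -
  define D :: "nat \<Rightarrow> nat \<Rightarrow> nat" where "D = (\<lambda>s s'. if s = s' then 0 else 1)"
  define Safe :: "(nat \<times> (nat \<Rightarrow> real)) \<times> nat \<Rightarrow> nat"
    where "Safe = (\<lambda>((s, x), a). if s \<noteq> 0 \<and> x 0 \<noteq> 0 then 0 else 1)"
  \<comment> \<open>The unit vector: its zeros from index 1 on put it in \<open>Rn 1\<close>, and
    its norm is exactly the continuous budget 1.\<close>
  define e :: "nat \<Rightarrow> real" where "e = (\<lambda>i. if i = 0 then 1 else 0)"
  have distance: "discrete_distance {0, 1} D"
    unfolding D_def by (rule discrete_distance_01)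
  have Safe: "Safe \<in> ({0, 1} \<times> Rn 1) \<times> {0} \<rightarrow> {0, 1}"
    by (auto simp: Safe_def split: if_splits)
  have point: "(0, \<lambda>_. 0) \<in> {0, 1 :: nat} \<times> Rn 1"
    by (simp add: topspace_Euclidean_space)
  have continuous: "\<forall>x' \<in> cont_ball 1 (\<lambda>_. 0) 1. Safe ((0, x'), 0) = 1"
    by (simp add: Safe_def)
  have discrete: "\<forall>s' \<in> disc_nbhd {0, 1} D 1 0. Safe ((s', \<lambda>_. 0), 0) = 1"
    by (simp add: Safe_def)
  have unsafe: "\<exists>s' \<in> disc_nbhd {0, 1} D 1 0. \<exists>x' \<in> cont_ball 1 (\<lambda>_. 0) 1. Safe ((s', x'), 0) = 0"
  proof (intro bexI)
    \<comment> \<open>Both budgets are spent in full: one edit and a step of length 1. The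
      neighbourhood and the ball are closed, so the pair is admissible.\<close>
    show "Safe ((1, e), 0) = 0"
      by (simp add: Safe_def e_def)
    show "e \<in> cont_ball 1 (\<lambda>_. 0) 1"
      by (simp add: e_def cont_ball_def euclid_norm_def topspace_Euclidean_space L2_set_def)
    show "1 \<in> disc_nbhd {0, 1} D 1 0"
      by (simp add: disc_nbhd_def D_def)
  qed
  show ?thesis
    \<comment> \<open>Unification supplies the witnesses: \<open>order_refl\<close> sets k = 1,
      \<open>zero_less_one\<close> sets \<epsilon> = 1, and \<open>discrete\<close> sets d =
      1.\<close>
    by (intro exI conjI) (rule distance order_refl Safe point singletonI zero_less_one
        continuous discrete unsafe)+
qed

end
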